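(* Let $\{A_0,B_0\}$ be a pair of maximal abelian *-subalgebras of $M_n(\mathbb{C})$. Then $\{A_0,B_0\}$ is an orthogonal pair if and only if $$h(A_0\mid B_0)=\log n=\max h(A\mid B),$$ where the maximum is taken over all pairs $\{A,B\}$ of maximal abelian *-subalgebras of $M_n(\mathbb{C})$.
   Context: Let $\eta(t)=-t\log t$ for $t>0$ and $\eta(0)=0$. Let $\tau$ be the normalized trace of $M_n(\mathbb{C})$, and for a unital *-subalgebra $A$ let $E_A$ be the $\tau$-preserving conditional expectation of $M_n(\mathbb{C})$ onto $A$. For unital *-subalgebras $A,B$ of $M_n(\mathbb{C})$, the conditional relative entropy of $A$ and $B$ conditioned by $A$ is $$h(A\mid B)=\sup_{(x_i)}\sum_i\Big(\tau\big(\eta(E_B(E_A(x_i)))\big)-\tau\big(\eta(E_A(x_i))\big)\Big),$$ where the supremum is over all finite families $(x_i)$ of positive elements of $M_n(\mathbb{C})$ with $\sum_i x_i=1$ and $\eta$ is applied by functional calculus. Two maximal abelian *-subalgebras $A$ and $B$ of $M_n(\mathbb{C})$ are orthogonal (in the sense of Popa) if $A\cap B=\mathbb{C}1$ and $E_AE_B=E_BE_A=E_{A\cap B}=E_{\mathbb{C}1}$. *)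

theory Defs
  imports "HOL-Analysis.Analysis" "HOL-Library.Extended_Real"
begin

type_synonym 'n cmat = "complex^'n^'n"

definition adj :: "'n::finite cmat \<Rightarrow> 'n cmat" where
  "adj x = (\<chi> i j. cnj (x $ j $ i))"

definition cscale :: "complex \<Rightarrow> 'n::finite cmat \<Rightarrow> 'n cmat" where
  "cscale c x = (\<chi> i j. c * x $ i $ j)"

definition ntrace :: "'n::finite cmat \<Rightarrow> complex" where
  "ntrace x = trace x / of_nat CARD('n)"

definition positive_mat :: "'n::finite cmat \<Rightarrow> bool" where
  "positive_mat x \<longleftrightarrow>
     adj x = x \<and> (\<forall>v. 0 \<le> Re (\<Sum>i\<in>UNIV. cnj (v $ i) * (x *v v) $ i))"

definition unitary_mat :: "'n::finite cmat \<Rightarrow> bool" where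
  "unitary_mat u \<longleftrightarrow> adj u ** u = mat 1 \<and> u ** adj u = mat 1"

definition real_diag :: "('n::finite \<Rightarrow> real) \<Rightarrow> 'n cmat" where
  "real_diag d = (\<chi> i j. if i = j then of_real (d i) else 0)"

text \<open>Functional calculus of a self-adjoint matrix. The result does not depend on the chosen
  diagonalization; for matrices that are not self-adjoint the value is unspecified.\<close>

definition fun_calc :: "(real \<Rightarrow> real) \<Rightarrow> 'n::finite cmat \<Rightarrow> 'n cmat" where
  "fun_calc f x = (THE y. \<exists>u d. unitary_mat u \<and>
      x = u ** real_diag d ** adj u \<and> y = u ** real_diag (\<lambda>i. f (d i)) ** adj u)"

definition eta :: "real \<Rightarrow> real" where
  "eta t = (if t = 0 then 0 else - t * ln t)"

definition unital_star_subalgebra :: "'n::finite cmat set \<Rightarrow> bool" where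
  "unital_star_subalgebra A \<longleftrightarrow>
     mat 1 \<in> A \<and>
     (\<forall>x\<in>A. \<forall>y\<in>A. x + y \<in> A \<and> x ** y \<in> A) \<and>
     (\<forall>c. \<forall>x\<in>A. cscale c x \<in> A) \<and>
     (\<forall>x\<in>A. adj x \<in> A)"

definition abelian :: "'n::finite cmat set \<Rightarrow> bool" where
  "abelian A \<longleftrightarrow> (\<forall>x\<in>A. \<forall>y\<in>A. x ** y = y ** x)"

text \<open>Competitors may be assumed unital: anything containing \<open>A\<close> contains the identity.\<close>

definition masa :: "'n::finite cmat set \<Rightarrow> bool" where
  "masa A \<longleftrightarrow> unital_star_subalgebra A \<and> abelian A \<and>
     (\<forall>C. unital_star_subalgebra C \<and> abelian C \<and> A \<subseteq> C \<longrightarrow> C = A)"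

definition trace_preserving_cond_exp ::
    "'n::finite cmat set \<Rightarrow> ('n cmat \<Rightarrow> 'n cmat) \<Rightarrow> bool" where
  "trace_preserving_cond_exp A E \<longleftrightarrow>
     (\<forall>x y. E (x + y) = E x + E y) \<and>
     (\<forall>c x. E (cscale c x) = cscale c (E x)) \<and>
     (\<forall>x. E x \<in> A) \<and>
     (\<forall>a\<in>A. E a = a) \<and>
     (\<forall>a\<in>A. \<forall>b\<in>A. \<forall>x. E (a ** x ** b) = a ** E x ** b) \<and>
     (\<forall>x. positive_mat x \<longrightarrow> positive_mat (E x)) \<and>
     (\<forall>x. ntrace (E x) = ntrace x)"

text \<open>For a unital *-subalgebra such a map exists and is unique.\<close>

definition cond_exp :: "'n::finite cmat set \<Rightarrow> 'n cmat \<Rightarrow> 'n cmat" where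
  "cond_exp A = (THE E. trace_preserving_cond_exp A E)"

text \<open>The supremum is taken in the extended reals, so that no boundedness is presupposed.
  The traces occurring here are real, hence \<open>Re\<close> is only a coercion.\<close>

definition cond_rel_entropy :: "'n::finite cmat set \<Rightarrow> 'n cmat set \<Rightarrow> ereal" where
  "cond_rel_entropy A B =
     Sup {ereal (\<Sum>i<k. Re (ntrace (fun_calc eta (cond_exp B (cond_exp A (x i)))))
                        - Re (ntrace (fun_calc eta (cond_exp A (x i)))))
          | (k::nat) (x :: nat \<Rightarrow> 'n cmat).
            (\<forall>i<k. positive_mat (x i)) \<and> (\<Sum>i<k. x i) = mat 1}"

definition scalar_mats :: "'n::finite cmat set" where
  "scalar_mats = range (\<lambda>c. cscale c (mat 1))"

definition popa_orthogonal :: "'n::finite cmat set \<Rightarrow> 'n cmat set \<Rightarrow> bool" where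
  "popa_orthogonal A B \<longleftrightarrow>
     A \<inter> B = scalar_mats \<and>
     cond_exp A \<circ> cond_exp B = cond_exp B \<circ> cond_exp A \<and>
     cond_exp B \<circ> cond_exp A = cond_exp (A \<inter> B) \<and>
     cond_exp (A \<inter> B) = cond_exp scalar_mats"

text \<open>Not \<open>Max\<close>, which is only meaningful for finite sets.\<close>

definition is_maximum :: "'a::order \<Rightarrow> 'a set \<Rightarrow> bool" where
  "is_maximum m S \<longleftrightarrow> m \<in> S \<and> (\<forall>s\<in>S. s \<le> m)"

end

theory Submission
  imports Defs
begin

text \<open>A maximal abelian *-subalgebra is \<open>u D u\<^sup>*\<close> with \<open>u\<close> unitary and \<open>D\<close> the diagonal matrices, and
  its conditional expectation keeps the diagonal of \<open>u\<^sup>* x u\<close>. For two of them, given by \<open>u\<close> and \<open>v\<close>,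
  let \<open>c i j\<close> be the squared moduli of the entries of \<open>v\<^sup>* u\<close>, a doubly stochastic matrix.
  Subadditivity of \<open>\<eta>\<close> and \<open>\<eta> (a b) = b \<eta> a + a \<eta> b\<close> bound \<open>h(A|B)\<close> by \<open>(1/n) \<Sum>i j. \<eta> (c i j)\<close>, and
  the minimal projections of \<open>A\<close> attain this bound. The tangent of \<open>\<eta>\<close> at \<open>1/n\<close> shows that the value
  is at most \<open>ln n\<close>, with equality iff all \<open>c i j\<close> equal \<open>1/n\<close>; evaluating \<open>E\<^sub>B E\<^sub>A\<close> on minimal projections
  shows that this is orthogonality.\<close>

section \<open>The complex inner product, adjoints, and eigenvectors of self-adjoint
  matrices\<close>

definition cip :: "complex^'n::finite \<Rightarrow> complex^'n \<Rightarrow> complex" where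
  "cip v w = (\<Sum>i\<in>UNIV. cnj (v $ i) * w $ i)"

definition diag_mat :: "('n::finite \<Rightarrow> complex) \<Rightarrow> 'n cmat" where
  "diag_mat c = (\<chi> i j. if i = j then c i else 0)"

definition conj_diag :: "'n::finite cmat \<Rightarrow> ('n \<Rightarrow> complex) \<Rightarrow> 'n cmat" where
  "conj_diag u c = u ** diag_mat c ** adj u"

definition conj_entry :: "'n::finite cmat \<Rightarrow> 'n cmat \<Rightarrow> 'n \<Rightarrow> complex" where
  "conj_entry u x i = (adj u ** x ** u) $ i $ i"

lemma inner_eq_Re_cip: "v \<bullet> w = Re (cip v w)"
  by (simp add: inner_vec_def cip_def inner_complex_def)

text \<open>Complex orthogonality to \<open>v\<close> thereby becomes real orthogonality to
  \<open>v\<close> and \<open>\<i> *s v\<close>, so that a real dimension count can produce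
  orthogonal vectors.\<close>

lemma cip_eq_inner: "cip v w = Complex (v \<bullet> w) ((\<i> *s v) \<bullet> w)"
  by (simp add: inner_eq_Re_cip complex_eq_iff) (simp add: cip_def algebra_simps sum_negf[symmetric])

lemma cip_adj: "cip v (x *v w) = cip (adj x *v v) w"
  unfolding cip_def adj_def matrix_vector_mult_def
  by (simp add: sum_distrib_left sum_distrib_right mult_ac) (rule sum.swap)

lemma cip_add_right: "cip v (w + w') = cip v w + cip v w'"
  by (simp add: cip_def algebra_simps sum.distrib)

lemma cip_scale_left: "cip (c *s v) w = cnj c * cip v w"
  by (simp add: cip_def sum_distrib_left mult_ac)

lemma cip_scale_right: "cip v (c *s w) = c * cip v w"
  by (simp add: cip_def sum_distrib_left mult_ac)

lemma cip_commute: "cip w v = cnj (cip v w)"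
  by (simp add: cip_def mult_ac)

lemma cip_self: "cip v v = of_real ((norm v)\<^sup>2)"
proof -
  have "Im (cip v v) = 0" by (metis cip_commute cnj.simps(2) equal_neg_zero)
  then show ?thesis by (simp add: complex_eq_iff inner_eq_Re_cip[symmetric] power2_norm_eq_inner)
qed

lemma adj_adj [simp]: "adj (adj x) = x"
  by (simp add: adj_def vec_eq_iff)

lemma adj_mult: "adj (x ** y) = adj y ** adj x"
  by (simp add: adj_def vec_eq_iff matrix_matrix_mult_def mult.commute)

lemma adj_add: "adj (x + y) = adj x + adj y"
  by (simp add: adj_def vec_eq_iff)

lemma cscale_mult_vec: "cscale c x *v v = c *s (x *v v)"
  by (simp add: cscale_def vec_eq_iff matrix_vector_mult_def sum_distrib_left mult_ac)

lemma cscale_mult_left: "cscale c x ** y = cscale c (x ** y)"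
  by (simp add: cscale_def vec_eq_iff matrix_matrix_mult_def sum_distrib_left mult_ac)

lemma cscale_mult_right: "x ** cscale c y = cscale c (x ** y)"
  by (simp add: cscale_def vec_eq_iff matrix_matrix_mult_def sum_distrib_left mult_ac)

lemma scaleR_eq_vec_scale: "r *\<^sub>R (v :: complex^'n) = complex_of_real r *s v"
  by (simp add: vec_eq_iff) (simp add: scaleR_conv_of_real)

lemma matrix_vec_scale: "x *v (c *s v) = c *s (x *v (v :: complex^'n::finite))"
  by (simp add: vec_eq_iff matrix_vector_mult_def sum_distrib_left mult_ac)

lemma linear_cmat: "linear ((*v) (x :: 'n::finite cmat))"
  by (rule linearI) (simp_all add: matrix_vector_right_distrib scaleR_eq_vec_scale matrix_vec_scale)

text \<open>A maximiser of the Rayleigh quotient on \<open>V\<close> is an eigenvector; only the real inner product is used.\<close>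

lemma self_adjoint_eigenvector:
  fixes x :: "'n::finite cmat"
  assumes sa: "adj x = x" and V: "subspace V" "V \<noteq> {0}" and inv: "\<And>v. v \<in> V \<Longrightarrow> x *v v \<in> V"
  shows "\<exists>v\<in>V. v \<noteq> 0 \<and> (\<exists>r. x *v v = r *\<^sub>R v)"
proof -
  let ?S = "V \<inter> sphere 0 1" and ?f = "\<lambda>v. v \<bullet> (x *v v)"
  obtain v0 where v0: "v0 \<in> V" "v0 \<noteq> 0"
    using V subspace_0 by blast
  have "(1 / norm v0) *\<^sub>R v0 \<in> ?S"
    using v0 V by (simp add: subspace_scale)
  moreover have "compact ?S"
    using closed_Int_compact[OF closed_subspace[OF V(1)] compact_sphere] .
  moreover have "continuous_on ?S ?f"
    by (intro continuous_intros linear_continuous_on_compose[OF _ linear_cmat])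
  ultimately obtain v where v: "v \<in> ?S" and max: "\<And>w. w \<in> ?S \<Longrightarrow> ?f w \<le> ?f v"
    using continuous_attains_sup[of ?S ?f] by blast
  define M where "M = ?f v"
  have le: "?f w \<le> M * (w \<bullet> w)" if "w \<in> V" for w
  proof (cases "w = 0")
    case False
    have "(1 / norm w) *\<^sub>R w \<in> ?S" using that False V by (simp add: subspace_scale)
    from max[OF this] have "?f w / (norm w)\<^sup>2 \<le> M"
      by (simp add: linear_scale[OF linear_cmat] M_def power2_eq_square)
    then show ?thesis using False
      by (simp add: power2_norm_eq_inner[symmetric] field_simps)
  qed (simp add: linear_0[OF linear_cmat])
  \<comment> \<open>The residual of the eigenvalue equation. It stays in \<open>V\<close>, so
    \<open>v\<close> may be perturbed along it; \<open>q\<close> is what the maximality of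
    \<open>v\<close> then says.\<close>
  define z where "z = x *v v - M *\<^sub>R v"
  have zV: "z \<in> V" using v inv V by (simp add: z_def subspace_diff subspace_scale)
  have sym: "a \<bullet> (x *v b) = b \<bullet> (x *v a)" for a b
    by (metis cip_adj sa inner_commute inner_eq_Re_cip)
  have vv: "v \<bullet> v = 1" using v by (simp add: power2_norm_eq_inner[symmetric])
  have q: "2 * t * (z \<bullet> z) \<le> t\<^sup>2 * (M * (z \<bullet> z) - ?f z)" for t
  proof -
    have "v + t *\<^sub>R z \<in> V" using v zV V by (simp add: subspace_add subspace_scale)
    from le[OF this] have "?f v + 2 * t * (z \<bullet> (x *v v)) + t\<^sup>2 * ?f z
        \<le> M * (1 + 2 * t * (z \<bullet> v) + t\<^sup>2 * (z \<bullet> z))"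
      using sym[of v z] vv
      by (simp add: linear_add[OF linear_cmat] linear_scale[OF linear_cmat] inner_add_left
          inner_add_right power2_eq_square algebra_simps inner_commute[of v z])
    moreover have "z \<bullet> (x *v v) = z \<bullet> z + M * (z \<bullet> v)"
      by (simp add: z_def inner_diff_right)
    ultimately show ?thesis by (simp add: M_def[symmetric] algebra_simps)
  qed
  have "z = 0"
  proof (rule ccontr)
    assume "z \<noteq> 0"
    define s where "s = z \<bullet> z"
    define K where "K = \<bar>M * (z \<bullet> z) - ?f z\<bar>"
    have s: "s > 0" using \<open>z \<noteq> 0\<close> by (simp add: s_def)
    have K: "K \<ge> 0" by (simp add: K_def)
    \<comment> \<open>The choice t = s/(K + 1) keeps the second-order term at most t s, half of the
      first-order term 2 t s; adding 1 keeps the quotient meaningful for K = 0.\<close>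
    have "2 * (s / (K + 1)) * s \<le> (s / (K + 1))\<^sup>2 * K"
      using q[of "s / (K + 1)"] unfolding s_def[symmetric]
      by (rule order_trans) (simp add: mult_left_mono K_def s_def)
    also have "\<dots> \<le> (s / (K + 1))\<^sup>2 * (K + 1)" by (intro mult_left_mono) auto
    also have "\<dots> = (s / (K + 1)) * s" using K by (simp add: power2_eq_square)
    finally have "2 * (s / (K + 1) * s) \<le> s / (K + 1) * s" by (simp add: mult.assoc)
    moreover have "s / (K + 1) * s > 0" using s K by simp
    ultimately show False by linarith
  qed
  then show ?thesis using v by (intro bexI[of _ v]) (auto simp: z_def)
qed


section \<open>Simultaneous diagonalization of an abelian algebra closed under adjoints\<close>

definition common_eigenvector :: "'n::finite cmat set \<Rightarrow> complex^'n \<Rightarrow> bool" where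
  "common_eigenvector A v \<longleftrightarrow> (\<forall>x\<in>A. \<exists>c. x *v v = c *s v)"

text \<open>On a nonzero invariant subspace of minimal dimension every self-adjoint \<open>h \<in> A\<close> is a scalar, because
  its eigenspaces are again invariant. Real subspaces suffice: invariance under \<open>\<i> 1 \<in> A\<close> makes them complex.\<close>

lemma common_eigenvector_exists:
  fixes A :: "'n::finite cmat set"
  assumes A: "unital_star_subalgebra A" "abelian A"
    and W: "subspace W" "W \<noteq> {0}" and inv: "\<And>x v. x \<in> A \<Longrightarrow> v \<in> W \<Longrightarrow> x *v v \<in> W"
  shows "\<exists>v\<in>W. norm v = 1 \<and> common_eigenvector A v"
proof -
  let ?P = "\<lambda>V. subspace V \<and> V \<noteq> {0} \<and> V \<subseteq> W \<and> (\<forall>x\<in>A. \<forall>v\<in>V. x *v v \<in> V)"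
  have "?P W" using W inv by blast
  from ex_has_least_nat[of ?P, OF this, of dim]
  obtain V where *: "?P V \<and> (\<forall>V'. ?P V' \<longrightarrow> dim V \<le> dim V')" ..
  note V = conjunct1[OF *] and min = conjunct2[OF *]
  have sa: "\<exists>r. \<forall>v\<in>V. h *v v = r *\<^sub>R v" if h: "h \<in> A" "adj h = h" for h
  proof -
    obtain v r where vr: "v \<in> V" "v \<noteq> 0" "h *v v = r *\<^sub>R v"
      using self_adjoint_eigenvector[of h V] h V by blast
    let ?V' = "{v \<in> V. h *v v = r *\<^sub>R v}"
    have sub: "subspace ?V'"
      using V by (auto simp: subspace_def linear_add[OF linear_cmat] linear_scale[OF linear_cmat]
          linear_0[OF linear_cmat] scaleR_add_right)
    have "x *v w \<in> ?V'" if "x \<in> A" "w \<in> ?V'" for x w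
    proof -
      have "h *v (x *v w) = x *v (h *v w)"
        using A(2) h(1) that(1) by (metis abelian_def matrix_vector_mul_assoc)
      with that V show ?thesis by (auto simp: linear_scale[OF linear_cmat])
    qed
    with sub vr V have "?P ?V'" by blast
    then have "dim V \<le> dim ?V'" by (rule min[THEN spec, THEN mp])
    with sub V have "?V' = V" by (intro subspace_dim_equal) simp_all
    then show ?thesis by blast
  qed
  have eig: "\<exists>c. \<forall>v\<in>V. x *v v = c *s v" if x: "x \<in> A" for x
  proof -
    \<comment> \<open>Cartesian decomposition x = (h - \<i> k)/2 with h and k self-adjoint members
      of \<open>A\<close>: their real scalars combine to a complex scalar for
      \<open>x\<close>.\<close>
    let ?h = "x + adj x" and ?k = "cscale \<i> (x + cscale (-1) (adj x))"
    have "?h \<in> A" "?k \<in> A" using x A(1) by (auto simp: unital_star_subalgebra_def)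
    moreover have "adj ?h = ?h" by (simp add: adj_add add.commute)
    moreover have "adj ?k = ?k" by (simp add: adj_def cscale_def vec_eq_iff algebra_simps)
    ultimately obtain r s where r: "\<And>v. v \<in> V \<Longrightarrow> ?h *v v = r *\<^sub>R v"
      and s: "\<And>v. v \<in> V \<Longrightarrow> ?k *v v = s *\<^sub>R v"
      using sa by metis
    have dec: "x = cscale (1/2) (?h + cscale (-\<i>) ?k)"
      by (simp add: cscale_def vec_eq_iff algebra_simps)
    have "x *v v = ((of_real r - \<i> * of_real s) / 2) *s v" if "v \<in> V" for v
    proof -
      have "x *v v = (1/2) *s (?h *v v + (-\<i>) *s (?k *v v))"
        by (subst dec) (simp only: cscale_mult_vec matrix_vector_mult_add_rdistrib)
      also have "\<dots> = ((of_real r - \<i> * of_real s) / 2) *s v"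
        unfolding r[OF that] s[OF that] scaleR_eq_vec_scale
        by (simp add: vec_eq_iff field_simps)
      finally show ?thesis .
    qed
    then show ?thesis by blast
  qed
  obtain v where v: "v \<in> V" "v \<noteq> 0" using V subspace_0 by blast
  define e where "e = (1 / norm v) *\<^sub>R v"
  have "e \<in> V" "norm e = 1" using v V by (simp_all add: e_def subspace_scale)
  moreover from eig have "common_eigenvector A e"
    using \<open>e \<in> V\<close> unfolding common_eigenvector_def by fast
  ultimately show ?thesis using V by blast
qed

text \<open>Induction on \<open>T\<close>: the orthogonal complement of the vectors found so far is
  invariant because \<open>A\<close> is closed under adjoints, and nonzero by dimension, so it
  contains a further common eigenvector. Indexing by subsets of the matrix index type makes the case
  \<open>UNIV\<close> supply all columns of a unitary.\<close>

lemma partial_common_eigenbasis: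
  fixes A :: "'n::finite cmat set" and T :: "'n set"
  assumes A: "unital_star_subalgebra A" "abelian A"
  shows "\<exists>f. (\<forall>i\<in>T. common_eigenvector A (f i)) \<and>
    (\<forall>i\<in>T. \<forall>j\<in>T. cip (f i) (f j) = (if i = j then 1 else 0))"
proof (induction T rule: finite_induct[OF finite])
  case (2 k T)
  then obtain f where eig: "\<And>i. i \<in> T \<Longrightarrow> common_eigenvector A (f i)"
    and orth: "\<And>i j. i \<in> T \<Longrightarrow> j \<in> T \<Longrightarrow> cip (f i) (f j) = (if i = j then 1 else 0)"
    by blast
  define W where "W = {w. \<forall>i\<in>T. cip (f i) w = 0}"
  \<comment> \<open>The real span of all \<open>f i\<close> and \<open>\<i> *s f i\<close> has
    dimension at most 2 |T|, less than the real dimension 2n of the whole space.\<close>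
  let ?S = "f ` T \<union> (\<lambda>i. \<i> *s f i) ` T"
  have "card ?S \<le> card T + card T"
    by (rule order_trans[OF card_Un_le]) (intro add_mono card_image_le; simp)
  also have "\<dots> < 2 * CARD('n)"
    using 2 psubset_card_mono[of UNIV T] by fastforce
  finally have "dim ?S < DIM(complex^'n)"
    using dim_le_card'[of ?S] by simp
  then obtain w where w: "w \<noteq> 0" "\<And>y. y \<in> span ?S \<Longrightarrow> orthogonal w y"
    using orthogonal_to_subspace_exists by blast
  have "y \<bullet> w = 0" if "y \<in> ?S" for y
    using w(2)[OF span_base[OF that]] by (simp add: orthogonal_def inner_commute)
  then have "w \<in> W"
    by (simp add: W_def cip_eq_inner complex_eq_iff)
  with w(1) have "W \<noteq> {0}" by blast
  moreover have "subspace W"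
    by (auto simp: W_def subspace_def cip_add_right scaleR_eq_vec_scale cip_scale_right)
       (simp add: cip_def)
  moreover have "x *v v \<in> W" if "x \<in> A" "v \<in> W" for x v
  proof -
    have "cip (f i) (x *v v) = 0" if i: "i \<in> T" for i
    proof -
      have "adj x \<in> A" using A \<open>x \<in> A\<close> by (simp add: unital_star_subalgebra_def)
      then obtain c where "adj x *v f i = c *s f i" using eig[OF i] common_eigenvector_def by blast
      with i \<open>v \<in> W\<close> show ?thesis by (simp add: cip_adj cip_scale_left W_def)
    qed
    then show ?thesis by (simp add: W_def)
  qed
  ultimately obtain v where v: "v \<in> W" "norm v = 1" "common_eigenvector A v"
    using common_eigenvector_exists[OF A] by blast
  have "cip v v = 1" using v by (simp add: cip_self)
  moreover have "cip (f i) v = 0" "cip v (f i) = 0" if "i \<in> T" for i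
    using that v(1) cip_commute[of v "f i"] by (auto simp: W_def)
  ultimately show ?case
    using eig orth v(3) 2(2) by (intro exI[of _ "f(k := v)"]) auto
qed simp

text \<open>The common eigenvectors are the columns of \<open>u\<close>, so the eigenvalue equations
  of \<open>x\<close> read \<open>x ** u = u ** diag_mat c\<close>.\<close>

lemma unitary_diagonalization:
  fixes A :: "'n::finite cmat set"
  assumes A: "unital_star_subalgebra A" "abelian A"
  shows "\<exists>u. unitary_mat u \<and> A \<subseteq> range (conj_diag u)"
proof -
  obtain f where eig: "\<And>i::'n. common_eigenvector A (f i)"
    and orth: "\<And>i j. cip (f i) (f j) = (if i = j then 1 else 0)"
    using partial_common_eigenbasis[OF A, of UNIV] by auto
  define u where "u = (\<chi> i j. f j $ i)"
  have 1: "adj u ** u = mat 1"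
    using orth by (simp add: vec_eq_iff u_def adj_def matrix_matrix_mult_def cip_def mat_def)
  then have 2: "u ** adj u = mat 1" by (simp add: matrix_left_right_inverse)
  have "x \<in> range (conj_diag u)" if x: "x \<in> A" for x
  proof -
    obtain c where c: "\<And>i. x *v f i = c i *s f i"
      using eig x unfolding common_eigenvector_def by meson
    have "x ** u = u ** diag_mat c"
    proof -
      have "(x ** u) $ i $ j = (u ** diag_mat c) $ i $ j" for i j
        using arg_cong[OF c[of j], of "\<lambda>v. v $ i"]
        by (simp add: u_def matrix_matrix_mult_def matrix_vector_mult_def diag_mat_def
            if_distrib cong: if_cong)
      then show ?thesis by (simp add: vec_eq_iff)
    qed
    then have "conj_diag u c = x ** (u ** adj u)"
      by (simp add: conj_diag_def matrix_mul_assoc)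
    then show ?thesis using 2 by (metis matrix_mul_rid rangeI)
  qed
  with 1 2 show ?thesis unfolding unitary_mat_def by blast
qed

section \<open>Calculus of matrices that are diagonal in a unitary frame\<close>

lemma matrix_add_rdistrib: "(x + y) ** z = x ** z + y ** (z :: 'n::finite cmat)"
  by (simp add: vec_eq_iff matrix_matrix_mult_def algebra_simps sum.distrib)

lemma diag_mat_mult_entry:
  "(diag_mat c ** y) $ i $ j = c i * y $ i $ j"
  "(y ** diag_mat d) $ i $ j = y $ i $ j * d j"
  by (simp_all add: diag_mat_def matrix_matrix_mult_def if_distrib if_distribR cong: if_cong)

lemma diag_mat_mult: "diag_mat c ** diag_mat d = diag_mat (\<lambda>i. c i * d i)"
  by (simp add: vec_eq_iff diag_mat_mult_entry) (simp add: diag_mat_def)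

lemma diag_mat_one: "diag_mat (\<lambda>_. 1) = mat 1"
  by (simp add: diag_mat_def mat_def)

text \<open>The last two equations cancel inside left-associated products, the form to which
  \<open>matrix_mul_assoc\<close> rewrites.\<close>

lemma unitary_cancel:
  assumes "unitary_mat u"
  shows "adj u ** u = mat 1" "u ** adj u = mat 1" "x ** adj u ** u = x" "x ** u ** adj u = x"
  using assms unfolding unitary_mat_def matrix_mul_assoc[symmetric] by auto

lemma conj_diag_mult:
  "unitary_mat u \<Longrightarrow> conj_diag u c ** conj_diag u d = conj_diag u (\<lambda>i. c i * d i)"
  by (simp add: conj_diag_def matrix_mul_assoc unitary_cancel flip: diag_mat_mult)

lemma conj_diag_add: "conj_diag u c + conj_diag u d = conj_diag u (\<lambda>i. c i + d i)"
proof -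
  have "diag_mat (\<lambda>i. c i + d i) = diag_mat c + diag_mat d" by (simp add: vec_eq_iff diag_mat_def)
  then show ?thesis by (simp add: conj_diag_def matrix_add_ldistrib matrix_add_rdistrib)
qed

lemma cscale_conj_diag: "cscale a (conj_diag u c) = conj_diag u (\<lambda>i. a * c i)"
proof -
  have "diag_mat (\<lambda>i. a * c i) = cscale a (diag_mat c)"
    by (simp add: vec_eq_iff diag_mat_def cscale_def)
  then show ?thesis by (simp add: conj_diag_def cscale_mult_left cscale_mult_right)
qed

lemma adj_conj_diag: "adj (conj_diag u c) = conj_diag u (\<lambda>i. cnj (c i))"
proof -
  have "adj (diag_mat c) = diag_mat (\<lambda>i. cnj (c i))" by (simp add: vec_eq_iff diag_mat_def adj_def)
  then show ?thesis by (simp add: conj_diag_def adj_mult matrix_mul_assoc)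
qed

lemma conj_diag_const: "unitary_mat u \<Longrightarrow> conj_diag u (\<lambda>_. c) = cscale c (mat 1)"
proof -
  assume u: "unitary_mat u"
  have "conj_diag u (\<lambda>_. 1) = mat 1"
    using u by (simp add: conj_diag_def diag_mat_one unitary_cancel)
  then show ?thesis using cscale_conj_diag[of c u "\<lambda>_. 1"] by simp
qed

lemma conj_entry_conj_diag: "unitary_mat u \<Longrightarrow> conj_entry u (conj_diag u c) = c"
  by (rule ext) (simp add: conj_entry_def conj_diag_def matrix_mul_assoc unitary_cancel,
      simp add: diag_mat_def)

lemma conj_entry_add: "conj_entry u (x + y) i = conj_entry u x i + conj_entry u y i"
  by (simp add: conj_entry_def matrix_add_ldistrib matrix_add_rdistrib)

lemma conj_entry_cscale: "conj_entry u (cscale c x) i = c * conj_entry u x i"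
  by (simp add: conj_entry_def cscale_mult_left cscale_mult_right) (simp add: cscale_def)

lemma conj_entry_sum: "finite I \<Longrightarrow> conj_entry u (\<Sum>k\<in>I. x k) i = (\<Sum>k\<in>I. conj_entry u (x k) i)"
  by (induction I rule: finite_induct)
     (simp_all add: conj_entry_add, simp add: conj_entry_def matrix_matrix_mult_def)

lemma conj_entry_bimodule:
  "unitary_mat u \<Longrightarrow> conj_entry u (conj_diag u c ** x ** conj_diag u d) i = c i * conj_entry u x i * d i"
  using diag_mat_mult_entry(1)[of c "adj u ** x ** u" i i]
  by (simp add: conj_entry_def conj_diag_def matrix_mul_assoc unitary_cancel diag_mat_mult_entry(2))

lemma conj_entry_mat_1: "unitary_mat u \<Longrightarrow> conj_entry u (mat 1) i = 1"
  by (simp add: conj_entry_def unitary_cancel) (simp add: mat_def)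

text \<open>Seen as the quadratic form of \<open>x\<close> at a column of \<open>u\<close>, the
  diagonal entry inherits reality and sign from positivity of \<open>x\<close>.\<close>

lemma conj_entry_eq_cip: "conj_entry u x i = cip (column i u) (x *v column i u)"
  unfolding cip_adj
  by (simp add: conj_entry_def adj_def matrix_matrix_mult_def matrix_vector_mult_def cip_def column_def mult_ac)

lemma conj_entry_positive:
  assumes "positive_mat x"
  shows "conj_entry u x i = of_real (Re (conj_entry u x i))" "0 \<le> Re (conj_entry u x i)"
proof -
  have "Im (conj_entry u x i) = 0"
    using assms unfolding conj_entry_eq_cip positive_mat_def
    by (metis cip_adj cip_commute cnj.simps(2) equal_neg_zero)
  then show "conj_entry u x i = of_real (Re (conj_entry u x i))" by (simp add: complex_eq_iff)
  show "0 \<le> Re (conj_entry u x i)"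
    using assms unfolding conj_entry_eq_cip positive_mat_def cip_def by blast
qed

lemma positive_conj_diag:
  assumes "\<And>i. 0 \<le> d i"
  shows "positive_mat (conj_diag u (\<lambda>i. of_real (d i)))"
proof -
  let ?x = "conj_diag u (\<lambda>i. of_real (d i))"
  have "0 \<le> Re (cip v (?x *v v))" for v
  proof -
    define z where "z = adj u *v v"
    have "cip v (?x *v v) = cip z (diag_mat (\<lambda>i. of_real (d i)) *v z)"
      by (simp add: conj_diag_def cip_adj z_def flip: matrix_vector_mul_assoc)
    also have "\<dots> = (\<Sum>i\<in>UNIV. of_real (d i) * (cnj (z $ i) * z $ i))"
      by (simp add: cip_def diag_mat_def matrix_vector_mult_def if_distrib if_distribR mult_ac cong: if_cong)
    also have "Re \<dots> = (\<Sum>i\<in>UNIV. d i * (cmod (z $ i))\<^sup>2)"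
      by (simp add: mult.commute[of "cnj _"] flip: complex_norm_square)
    finally show ?thesis using assms by (simp add: sum_nonneg)
  qed
  then show ?thesis by (simp add: positive_mat_def adj_conj_diag flip: cip_def)
qed

lemma ntrace_eq_conj_entry:
  fixes x :: "'n::finite cmat"
  assumes "unitary_mat u"
  shows "ntrace x = (\<Sum>i\<in>UNIV. conj_entry u x i) / of_nat CARD('n)"
proof -
  have "trace (adj u ** x ** u) = trace x"
    by (simp add: trace_mul_sym[of "adj u ** x"] matrix_mul_assoc unitary_cancel[OF assms])
  then show ?thesis by (simp add: ntrace_def trace_def conj_entry_def)
qed

section \<open>Maximal abelian subalgebras and conditional expectations\<close>

lemma unital_star_subalgebra_conj_diag:
  assumes u: "unitary_mat u"
  shows "unital_star_subalgebra (range (conj_diag u))" "abelian (range (conj_diag u))"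
proof -
  have "mat 1 = conj_diag u (\<lambda>_. 1)" using u by (simp add: conj_diag_def diag_mat_one unitary_cancel)
  then show "unital_star_subalgebra (range (conj_diag u))"
    unfolding unital_star_subalgebra_def
    by (auto simp: conj_diag_mult[OF u] conj_diag_add cscale_conj_diag adj_conj_diag)
  show "abelian (range (conj_diag u))"
    by (auto simp: abelian_def conj_diag_mult[OF u] mult.commute)
qed

text \<open>Diagonalization embeds \<open>A\<close> into \<open>range (conj_diag u)\<close>, itself
  an abelian unital *-subalgebra, so maximality of \<open>A\<close> forces equality.\<close>

lemma masa_eq_range_conj_diag:
  assumes "masa A"
  obtains u where "unitary_mat u" "A = range (conj_diag u)"
proof -
  obtain u where u: "unitary_mat u" "A \<subseteq> range (conj_diag u)"
    using assms unitary_diagonalization[of A] by (auto simp: masa_def)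
  with assms unital_star_subalgebra_conj_diag[of u] have "A = range (conj_diag u)"
    unfolding masa_def by blast
  with u that show ?thesis by blast
qed

lemma cond_exp_conj_diag:
  fixes u :: "'n::finite cmat"
  assumes u: "unitary_mat u"
  shows "cond_exp (range (conj_diag u)) = (\<lambda>x. conj_diag u (conj_entry u x))"
  unfolding cond_exp_def
proof (rule the_equality)
  show "trace_preserving_cond_exp (range (conj_diag u)) (\<lambda>x. conj_diag u (conj_entry u x))"
    unfolding trace_preserving_cond_exp_def
  proof (intro conjI allI impI ballI)
    fix x :: "'n cmat" assume "positive_mat x"
    note pos = conj_entry_positive[OF this, of u]
    have "conj_entry u x = (\<lambda>i. of_real (Re (conj_entry u x i)))"
      by (rule ext) (rule pos(1))
    then show "positive_mat (conj_diag u (conj_entry u x))"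
      using positive_conj_diag[of "\<lambda>i. Re (conj_entry u x i)" u] pos(2) by simp
  next
    fix a b x assume "a \<in> range (conj_diag u)" "b \<in> range (conj_diag u)"
    then show "conj_diag u (conj_entry u (a ** x ** b)) = a ** conj_diag u (conj_entry u x) ** b"
      by (auto simp: conj_entry_bimodule[OF u] conj_diag_mult[OF u]
          intro!: arg_cong[where f="conj_diag u"] ext)
  next
    fix x show "ntrace (conj_diag u (conj_entry u x)) = ntrace x"
      by (simp add: ntrace_eq_conj_entry[OF u] conj_entry_conj_diag[OF u])
  qed (auto simp: conj_entry_add conj_entry_cscale conj_diag_add cscale_conj_diag
       conj_entry_conj_diag[OF u] intro!: arg_cong[where f="conj_diag u"])
next
  fix E assume E: "trace_preserving_cond_exp (range (conj_diag u)) E"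
  show "E = (\<lambda>x. conj_diag u (conj_entry u x))"
  proof
    fix x
    obtain c where c: "E x = conj_diag u c"
      using E unfolding trace_preserving_cond_exp_def by blast
    have "c i = conj_entry u x i" for i
    proof -
      \<comment> \<open>The minimal projection at \<open>i\<close>. The compression
        \<open>p ** x ** p\<close> lies in the algebra, so \<open>E\<close> fixes it; the bimodule
        property also gives \<open>p ** E x ** p\<close>. Comparing the two determines
        \<open>c i\<close>.\<close>
      define p where "p = conj_diag u (\<lambda>j. if j = i then 1 else 0)"
      have "p ** x ** p = conj_diag u (\<lambda>j. if j = i then conj_entry u x i else 0)"
      proof -
        have "diag_mat (\<lambda>j. if j = i then 1 else 0) ** (adj u ** x ** u) **
            diag_mat (\<lambda>j. if j = i then 1 else 0) = diag_mat (\<lambda>j. if j = i then conj_entry u x i else 0)"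
          unfolding vec_eq_iff diag_mat_mult_entry by (simp add: diag_mat_def conj_entry_def)
        then have "u ** (diag_mat (\<lambda>j. if j = i then 1 else 0) ** (adj u ** x ** u) **
            diag_mat (\<lambda>j. if j = i then 1 else 0)) ** adj u
          = conj_diag u (\<lambda>j. if j = i then conj_entry u x i else 0)"
          by (simp add: conj_diag_def)
        then show ?thesis by (simp add: p_def conj_diag_def matrix_mul_assoc)
      qed
      moreover have "E (p ** x ** p) = p ** E x ** p"
        using E by (simp add: trace_preserving_cond_exp_def p_def)
      moreover have "E (conj_diag u d) = conj_diag u d" for d
        using E by (simp add: trace_preserving_cond_exp_def)
      ultimately have "conj_diag u (\<lambda>j. if j = i then conj_entry u x i else 0) = p ** conj_diag u c ** p"
        using c by metis
      from arg_cong[OF this, of "\<lambda>y. conj_entry u y i"] show ?thesis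
        by (simp add: p_def conj_diag_mult[OF u] conj_entry_conj_diag[OF u])
    qed
    then show "E x = conj_diag u (conj_entry u x)" unfolding c by (intro arg_cong[where f="conj_diag u"] ext)
  qed
qed

lemma ntrace_scalar: "ntrace (cscale c (mat 1 :: 'n::finite cmat)) = c"
  by (simp add: ntrace_def trace_def cscale_def mat_def)

text \<open>A scalar matrix is determined by its normalized trace, so trace preservation forces the
  value of any expectation onto the scalars.\<close>

lemma cond_exp_scalar_mats:
  "cond_exp (scalar_mats :: 'n::finite cmat set) = (\<lambda>x. cscale (ntrace x) (mat 1))"
  unfolding cond_exp_def
proof (rule the_equality)
  \<comment> \<open>Taking the identity as the frame makes the lemmas on diagonal entries available
    for the trace.\<close>
  have u: "unitary_mat (mat 1 :: 'n cmat)"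
  proof -
    have "adj (mat 1 :: 'n cmat) = mat 1" by (simp add: vec_eq_iff adj_def mat_def)
    then show ?thesis by (simp add: unitary_mat_def)
  qed
  note tr = ntrace_eq_conj_entry[OF u]
  show "trace_preserving_cond_exp scalar_mats (\<lambda>x::'n cmat. cscale (ntrace x) (mat 1))"
    unfolding trace_preserving_cond_exp_def
  proof (intro conjI allI impI ballI)
    fix x :: "'n cmat" assume x: "positive_mat x"
    define r where "r = (\<Sum>i\<in>UNIV. Re (conj_entry (mat 1) x i)) / real CARD('n)"
    have "ntrace x = of_real r"
      using conj_entry_positive(1)[OF x, of "mat 1"] unfolding tr r_def by simp
    moreover have "r \<ge> 0"
      unfolding r_def by (simp add: sum_nonneg conj_entry_positive(2)[OF x])
    ultimately show "positive_mat (cscale (ntrace x) (mat 1 :: 'n cmat))"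
      using positive_conj_diag[of "\<lambda>_. r" "mat 1 :: 'n cmat"] conj_diag_const[OF u] by simp
  next
    fix a b x :: "'n cmat" assume "a \<in> scalar_mats" "b \<in> scalar_mats"
    then obtain c d where ab: "a = cscale c (mat 1)" "b = cscale d (mat 1)"
      by (auto simp: scalar_mats_def)
    have "ntrace (cscale c x) = c * ntrace x" for c and x :: "'n cmat"
      by (simp add: tr conj_entry_cscale sum_distrib_left)
    then show "cscale (ntrace (a ** x ** b)) (mat 1) = a ** cscale (ntrace x) (mat 1) ** b"
      by (simp add: ab cscale_mult_left cscale_mult_right) (simp add: cscale_def vec_eq_iff)
  next
    fix x y :: "'n cmat"
    show "cscale (ntrace (x + y)) (mat 1 :: 'n cmat) = cscale (ntrace x) (mat 1) + cscale (ntrace y) (mat 1)"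
      by (simp add: tr conj_entry_add sum.distrib add_divide_distrib)
         (simp add: cscale_def vec_eq_iff algebra_simps)
  next
    fix c and x :: "'n cmat"
    show "cscale (ntrace (cscale c x)) (mat 1 :: 'n cmat) = cscale c (cscale (ntrace x) (mat 1))"
      by (simp add: tr conj_entry_cscale flip: sum_distrib_left)
         (simp add: cscale_def vec_eq_iff algebra_simps)
  qed (auto simp: scalar_mats_def ntrace_scalar)
next
  fix E :: "'n cmat \<Rightarrow> 'n cmat" assume E: "trace_preserving_cond_exp scalar_mats E"
  show "E = (\<lambda>x. cscale (ntrace x) (mat 1))"
  proof
    fix x
    obtain c where "E x = cscale c (mat 1)" "ntrace (E x) = ntrace x"
      using E unfolding trace_preserving_cond_exp_def scalar_mats_def by blast
    then show "E x = cscale (ntrace x) (mat 1)" by (simp add: ntrace_scalar)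
  qed
qed

section \<open>Functional calculus in a unitary frame\<close>

text \<open>Independence of the diagonalization: \<open>w = adj v ** u\<close> intertwines the two
  diagonals, so its entry at (i, j) can be nonzero only where \<open>c j = e i\<close>. There
  \<open>f\<close> takes equal values, hence \<open>w\<close> intertwines the images under
  \<open>f\<close> as well.\<close>

lemma conj_diag_functional_calculus:
  assumes u: "unitary_mat u" and v: "unitary_mat v" and eq: "conj_diag u c = conj_diag v e"
  shows "conj_diag u (\<lambda>i. f (c i)) = conj_diag v (\<lambda>i. f (e i))"
proof -
  define w where "w = adj v ** u"
  have "w ** diag_mat c = adj v ** conj_diag u c ** u"
    by (simp add: w_def conj_diag_def matrix_mul_assoc unitary_cancel[OF u])
  also have "\<dots> = diag_mat e ** w"
    unfolding eq by (simp add: w_def conj_diag_def matrix_mul_assoc unitary_cancel[OF v])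
  finally have "(w ** diag_mat c) $ i $ j = (diag_mat e ** w) $ i $ j" for i j by simp
  then have "w $ i $ j * c j = e i * w $ i $ j" for i j
    by (simp add: diag_mat_def matrix_matrix_mult_def if_distrib if_distribR cong: if_cong)
  then have "w $ i $ j * f (c j) = f (e i) * w $ i $ j" for i j
    by (cases "w $ i $ j = 0") (auto, metis mult.commute mult_cancel_left)
  then have "w ** diag_mat (\<lambda>i. f (c i)) = diag_mat (\<lambda>i. f (e i)) ** w"
    by (simp add: diag_mat_def matrix_matrix_mult_def if_distrib if_distribR vec_eq_iff cong: if_cong)
  then have "v ** (w ** diag_mat (\<lambda>i. f (c i))) ** adj u = v ** (diag_mat (\<lambda>i. f (e i)) ** w) ** adj u"
    by simp
  then show ?thesis
    by (simp add: w_def conj_diag_def matrix_mul_assoc unitary_cancel[OF u] unitary_cancel[OF v])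
qed

lemma fun_calc_conj_diag:
  assumes u: "unitary_mat u"
  shows "fun_calc f (conj_diag u (\<lambda>i. of_real (d i))) = conj_diag u (\<lambda>i. of_real (f (d i)))"
proof -
  have rd: "v ** real_diag e ** adj v = conj_diag v (\<lambda>i. of_real (e i))" for v and e :: "'a \<Rightarrow> real"
    by (simp add: conj_diag_def real_diag_def diag_mat_def)
  show ?thesis
    unfolding fun_calc_def rd
  proof (rule the_equality)
    fix y assume "\<exists>v e. unitary_mat v \<and> conj_diag u (\<lambda>i. of_real (d i)) = conj_diag v (\<lambda>i. of_real (e i))
      \<and> y = conj_diag v (\<lambda>i. of_real (f (e i)))"
    \<comment> \<open>The real function acts through \<open>Re\<close>, because the independence
      lemma concerns complex diagonals.\<close>
    then show "y = conj_diag u (\<lambda>i. of_real (f (d i)))"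
      using conj_diag_functional_calculus[OF u, of _ "\<lambda>i. of_real (d i)" _ "\<lambda>z. of_real (f (Re z))"]
      by fastforce
  qed (use u in blast)
qed

section \<open>The doubly stochastic matrix of a pair of unitary frames\<close>

text \<open>The squared modulus of the inner product of column j of \<open>v\<close> with column i
  of \<open>u\<close>: the transition probability between two orthonormal bases when both matrices
  are unitary.\<close>

definition overlap :: "'n::finite cmat \<Rightarrow> 'n cmat \<Rightarrow> 'n \<Rightarrow> 'n \<Rightarrow> real" where
  "overlap u v i j = (cmod ((adj v ** u) $ j $ i))\<^sup>2"

text \<open>For unitary frames, the overlaps are thus the matrix of the expectation onto the second
  algebra, restricted to the first.\<close>

lemma conj_entry_overlap:
  "conj_entry v (conj_diag u c) j = (\<Sum>i\<in>UNIV. of_real (overlap u v i j) * c i)"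
proof -
  define w where "w = adj v ** u"
  have "conj_entry v (conj_diag u c) j = (w ** diag_mat c ** adj w) $ j $ j"
    by (simp add: conj_entry_def conj_diag_def w_def adj_mult matrix_mul_assoc)
  also have "\<dots> = (\<Sum>i\<in>UNIV. (w ** diag_mat c) $ j $ i * cnj (w $ j $ i))"
    unfolding matrix_matrix_mult_def[of "w ** diag_mat c"] by (simp add: adj_def)
  also have "\<dots> = (\<Sum>i\<in>UNIV. of_real (overlap u v i j) * c i)"
    unfolding overlap_def w_def[symmetric] complex_norm_square diag_mat_mult_entry(2)
    by (simp add: mult_ac)
  finally show ?thesis .
qed

lemma overlap_nonneg: "0 \<le> overlap u v i j"
  by (simp add: overlap_def)

lemma overlap_commute: "overlap v u j i = overlap u v i j"
proof -
  have "adj u ** v = adj (adj v ** u)" by (simp add: adj_mult)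
  then show ?thesis by (simp add: overlap_def) (simp add: adj_def)
qed

text \<open>Apply \<open>conj_entry_overlap\<close> to the identity, whose diagonal entries are 1 in
  every unitary frame.\<close>

lemma sum_overlap_left:
  assumes u: "unitary_mat u" and v: "unitary_mat v"
  shows "(\<Sum>i\<in>UNIV. overlap u v i j) = 1"
proof -
  have "conj_diag u (\<lambda>_. 1) = mat 1" by (simp add: conj_diag_def diag_mat_one unitary_cancel u)
  then have "complex_of_real (\<Sum>i\<in>UNIV. overlap u v i j) = 1"
    using conj_entry_overlap[of v u "\<lambda>_. 1" j] conj_entry_mat_1[OF v] by simp
  then show ?thesis using of_real_eq_1_iff by blast
qed

lemma sum_overlap_right:
  "unitary_mat u \<Longrightarrow> unitary_mat v \<Longrightarrow> (\<Sum>j\<in>UNIV. overlap u v i j) = 1"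
  using sum_overlap_left[of v u i] by (simp add: overlap_commute)

section \<open>Inequalities for the entropy function\<close>

lemma eta_mult: "0 \<le> a \<Longrightarrow> 0 \<le> b \<Longrightarrow> eta (a * b) = b * eta a + a * eta b"
  by (auto simp: eta_def ln_mult algebra_simps)

text \<open>Each \<open>a i\<close> is at most the total s, so -ln s \<le> -ln (a i) for nonzero
  \<open>a i\<close>; weighting by \<open>a i\<close> and summing gives the claim. Zero terms
  contribute 0 on both sides.\<close>

lemma eta_sum_le:
  assumes "finite I" "\<And>i. i \<in> I \<Longrightarrow> 0 \<le> a i"
  shows "eta (\<Sum>i\<in>I. a i) \<le> (\<Sum>i\<in>I. eta (a i))"
proof (cases "(\<Sum>i\<in>I. a i) = 0")
  case True
  then have "a i = 0" if "i \<in> I" for i using assms that by (simp add: sum_nonneg_eq_0_iff)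
  then show ?thesis by (simp add: eta_def)
next
  case False
  let ?s = "\<Sum>i\<in>I. a i"
  have "eta ?s = (\<Sum>i\<in>I. - a i * ln ?s)"
    using False by (simp add: eta_def sum_distrib_right sum_negf)
  also have "\<dots> \<le> (\<Sum>i\<in>I. eta (a i))"
  proof (rule sum_mono)
    fix i assume i: "i \<in> I"
    then have "a i \<le> ?s" using assms by (intro member_le_sum) auto
    then show "- a i * ln ?s \<le> eta (a i)"
      using assms(2)[OF i] by (auto simp: eta_def intro!: mult_left_mono)
  qed
  finally show ?thesis .
qed

text \<open>The right-hand side is the tangent of \<open>eta\<close> at 1/m. For t > 0 the claim is
  ln y \<le> y - 1 at y = 1/(m t), scaled by t, with equality only for y = 1; at t = 0 the
  inequality is strict.\<close>

lemma eta_le_tangent: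
  assumes "0 \<le> t" "0 < m"
  shows "eta t \<le> t * ln m + (1 / m - t)"
    and "eta t = t * ln m + (1 / m - t) \<Longrightarrow> t = 1 / m"
proof -
  have *: "eta t = t * ln m + t * ln (1 / (m * t))" "t * (1 / (m * t) - 1) = 1 / m - t" if "t > 0"
    using that assms by (simp_all add: eta_def ln_div ln_mult algebra_simps)
  show "eta t \<le> t * ln m + (1 / m - t)"
  proof (cases "t = 0")
    case False
    with assms have "t > 0" by simp
    then have "t * ln (1 / (m * t)) \<le> t * (1 / (m * t) - 1)"
      using assms by (intro mult_left_mono ln_le_minus_one) auto
    then show ?thesis using *[OF \<open>t > 0\<close>] by simp
  qed (use assms in \<open>simp add: eta_def\<close>)
  assume eq: "eta t = t * ln m + (1 / m - t)"
  show "t = 1 / m"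
  proof (cases "t = 0")
    case False
    with assms have "t > 0" by simp
    then have "t * ln (1 / (m * t)) = t * (1 / (m * t) - 1)" using *[OF \<open>t > 0\<close>] eq by simp
    then have "ln (1 / (m * t)) = 1 / (m * t) - 1" using \<open>t > 0\<close> by simp
    then have "1 / (m * t) = 1" using \<open>t > 0\<close> assms by (intro ln_eq_minus_one) auto
    then show ?thesis using \<open>t > 0\<close> assms by (simp add: field_simps)
  qed (use eq assms in \<open>simp add: eta_def\<close>)
qed

section \<open>The value of the conditional relative entropy\<close>

text \<open>For unitary frames, the average Shannon entropy of the rows of the overlap
  matrix.\<close>

definition overlap_entropy :: "'n::finite cmat \<Rightarrow> 'n cmat \<Rightarrow> real" where
  "overlap_entropy u v = (\<Sum>i\<in>UNIV. \<Sum>j\<in>UNIV. eta (overlap u v i j)) / real CARD('n)"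

lemma overlap_entropy_le:
  fixes u v :: "'n::finite cmat"
  assumes u: "unitary_mat u" and v: "unitary_mat v"
  shows "overlap_entropy u v \<le> ln (real CARD('n))"
    and "overlap_entropy u v = ln (real CARD('n)) \<longleftrightarrow> (\<forall>i j. overlap u v i j = 1 / real CARD('n))"
proof -
  let ?n = "real CARD('n)"
  define b where "b i j = overlap u v i j * ln ?n + (1 / ?n - overlap u v i j)" for i j
  have le: "eta (overlap u v i j) \<le> b i j" for i j
    unfolding b_def by (intro eta_le_tangent overlap_nonneg) simp
  \<comment> \<open>Each row of overlaps sums to 1, so the linear corrections of the tangent cancel
    along it.\<close>
  have row: "(\<Sum>j\<in>UNIV. b i j) = ln ?n" for i
    by (simp add: b_def sum.distrib sum_subtractf sum_overlap_right[OF u v] flip: sum_distrib_right)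
  then have tot: "(\<Sum>i\<in>UNIV. \<Sum>j\<in>UNIV. b i j) = ?n * ln ?n" by simp
  have "(\<Sum>i\<in>UNIV. \<Sum>j\<in>UNIV. eta (overlap u v i j)) \<le> ?n * ln ?n"
    unfolding tot[symmetric] by (intro sum_mono le)
  then show "overlap_entropy u v \<le> ln ?n"
    by (simp add: overlap_entropy_def field_simps)
  show "overlap_entropy u v = ln ?n \<longleftrightarrow> (\<forall>i j. overlap u v i j = 1 / ?n)"
  proof
    assume "overlap_entropy u v = ln ?n"
    \<comment> \<open>Equality of the totals makes a sum of nonnegative gaps vanish; each gap is
      then 0, and the equality case of the tangent bound applies.\<close>
    then have "(\<Sum>i\<in>UNIV. \<Sum>j\<in>UNIV. b i j - eta (overlap u v i j)) = 0"
      by (simp add: sum_subtractf tot overlap_entropy_def field_simps)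
    then have "b i j - eta (overlap u v i j) = 0" for i j
      using le by (subst (asm) sum_nonneg_eq_0_iff) (auto simp: sum_nonneg sum_nonneg_eq_0_iff)
    then have "eta (overlap u v i j) = b i j" for i j by simp
    then show "\<forall>i j. overlap u v i j = 1 / ?n"
      unfolding b_def by (intro allI eta_le_tangent(2) overlap_nonneg) simp
  next
    assume "\<forall>i j. overlap u v i j = 1 / ?n"
    then show "overlap_entropy u v = ln ?n"
      by (simp add: overlap_entropy_def eta_def ln_div)
  qed
qed

lemma ntrace_fun_calc_conj_diag:
  fixes u :: "'n::finite cmat"
  assumes "unitary_mat u"
  shows "Re (ntrace (fun_calc f (conj_diag u (\<lambda>i. of_real (d i))))) = (\<Sum>i\<in>UNIV. f (d i)) / real CARD('n)"
  by (simp add: fun_calc_conj_diag[OF assms] ntrace_eq_conj_entry[OF assms] conj_entry_conj_diag[OF assms])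

lemma cond_rel_entropy_conj_diag:
  fixes u v :: "'n::finite cmat"
  assumes u: "unitary_mat u" and v: "unitary_mat v"
  shows "cond_rel_entropy (range (conj_diag u)) (range (conj_diag v)) = ereal (overlap_entropy u v)"
proof -
  let ?A = "range (conj_diag u)" and ?B = "range (conj_diag v)" and ?n = "real CARD('n)"
  let ?h = "\<lambda>x. Re (ntrace (fun_calc eta (cond_exp ?B (cond_exp ?A x))))
    - Re (ntrace (fun_calc eta (cond_exp ?A x)))"
  define d where "d x i = Re (conj_entry u x i)" for x i
  define H where "H i = (\<Sum>j\<in>UNIV. eta (overlap u v i j))" for i
  have EA: "cond_exp ?A x = conj_diag u (\<lambda>i. of_real (d x i))" if "positive_mat x" for x
    using conj_entry_positive(1)[OF that, of u] unfolding cond_exp_conj_diag[OF u] d_def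
    by (intro arg_cong[where f="conj_diag u"] ext)
  have EB: "cond_exp ?B (conj_diag u (\<lambda>i. of_real (e i)))
      = conj_diag v (\<lambda>j. of_real (\<Sum>i\<in>UNIV. overlap u v i j * e i))" for e
    unfolding cond_exp_conj_diag[OF v]
    by (intro arg_cong[where f="conj_diag v"] ext) (simp add: conj_entry_overlap)
  have h: "?h x = ((\<Sum>j\<in>UNIV. eta (\<Sum>i\<in>UNIV. overlap u v i j * d x i)) - (\<Sum>i\<in>UNIV. eta (d x i))) / ?n"
    if "positive_mat x" for x
    unfolding EA[OF that] EB ntrace_fun_calc_conj_diag[OF u] ntrace_fun_calc_conj_diag[OF v]
    by (simp add: diff_divide_distrib)
  \<comment> \<open>The product rule leaves terms \<open>eta (d x i)\<close> weighted by a row of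
    overlaps. As the row sums to 1, they cancel the subtracted entropy of the expectation onto
    \<open>?A\<close>, leaving a bound linear in \<open>d x\<close>, which can be summed over a
    partition of unity.\<close>
  have h_le: "?h x \<le> (\<Sum>i\<in>UNIV. d x i * H i) / ?n" if x: "positive_mat x" for x
  proof -
    have d: "0 \<le> d x i" for i using conj_entry_positive(2)[OF x] by (simp add: d_def)
    have "(\<Sum>j\<in>UNIV. eta (\<Sum>i\<in>UNIV. overlap u v i j * d x i))
        \<le> (\<Sum>j\<in>UNIV. \<Sum>i\<in>UNIV. eta (overlap u v i j * d x i))"
      by (intro sum_mono eta_sum_le mult_nonneg_nonneg overlap_nonneg d) simp
    also have "\<dots> = (\<Sum>i\<in>UNIV. \<Sum>j\<in>UNIV. d x i * eta (overlap u v i j) + overlap u v i j * eta (d x i))"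
      by (subst sum.swap) (simp add: eta_mult overlap_nonneg d)
    also have "\<dots> = (\<Sum>i\<in>UNIV. d x i * H i + eta (d x i))"
      by (simp add: H_def sum.distrib sum_distrib_left sum_overlap_right[OF u v] flip: sum_distrib_right)
    finally show ?thesis unfolding h[OF x]
      by (intro divide_right_mono) (simp_all add: sum.distrib)
  qed
  have oe: "overlap_entropy u v = (\<Sum>i\<in>UNIV. H i) / ?n"
    by (simp add: overlap_entropy_def H_def)
  have upper: "(\<Sum>k<m. ?h (x k)) \<le> overlap_entropy u v"
    if pos: "\<forall>k<m. positive_mat (x k)" and one: "(\<Sum>k<m. x k) = mat 1" for m and x :: "nat \<Rightarrow> 'n cmat"
  proof -
    have d1: "(\<Sum>k<m. d (x k) i) = 1" for i
    proof -
      have "(\<Sum>k<m. d (x k) i) = Re (conj_entry u (\<Sum>k<m. x k) i)"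
        by (simp add: d_def conj_entry_sum)
      then show ?thesis by (simp add: one conj_entry_mat_1[OF u])
    qed
    have "(\<Sum>k<m. ?h (x k)) \<le> (\<Sum>k<m. (\<Sum>i\<in>UNIV. d (x k) i * H i) / ?n)"
      using pos by (intro sum_mono h_le) simp
    also have "\<dots> = (\<Sum>i\<in>UNIV. (\<Sum>k<m. d (x k) i) * H i) / ?n"
      unfolding sum_distrib_right by (subst sum.swap) (simp add: sum_divide_distrib)
    also have "\<dots> = overlap_entropy u v" by (simp add: d1 oe)
    finally show ?thesis .
  qed
  \<comment> \<open>The minimal projections of \<open>?A\<close>: their own entropy vanishes, and
    the coefficients of \<open>p k\<close> after the expectation onto \<open>?B\<close> are row k of
    the overlaps.\<close>
  define p where "p k = conj_diag u (\<lambda>i. of_real (if i = k then 1 else 0))" for k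
  have p: "positive_mat (p k)" for k unfolding p_def by (rule positive_conj_diag) simp
  have dp: "d (p k) i = (if i = k then 1 else 0)" for k i
    by (simp add: d_def p_def conj_entry_conj_diag[OF u])
  have hp: "?h (p k) = H k / ?n" for k
    unfolding h[OF p] dp by (simp add: H_def eta_def if_distrib cong: if_cong)
  have sum_p: "(\<Sum>k\<in>UNIV. p k) = mat 1"
  proof -
    have "(\<Sum>k\<in>K. p k) = conj_diag u (\<lambda>i. if i \<in> K then 1 else 0)" for K
    proof (induction K rule: finite_induct[OF finite])
      case 1
      show ?case by (simp add: conj_diag_const[OF u]) (simp add: cscale_def vec_eq_iff)
    next
      case (2 k K)
      then show ?case
        by (simp add: p_def conj_diag_add) (rule arg_cong[where f="conj_diag u"], auto)
    qed
    from this[of UNIV] show ?thesis by (simp add: conj_diag_def diag_mat_one unitary_cancel[OF u])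
  qed
  \<comment> \<open>Families in the supremum are indexed by initial segments of the naturals, so the
    projections must be enumerated.\<close>
  obtain g where g: "bij_betw g {..<CARD('n)} (UNIV :: 'n set)"
    using ex_bij_betw_nat_finite[of "UNIV :: 'n set"] by (auto simp: atLeast0LessThan)
  have attained: "(\<Sum>k<CARD('n). ?h (p (g k))) = overlap_entropy u v" "(\<Sum>k<CARD('n). p (g k)) = mat 1"
    unfolding hp oe sum_p[symmetric] using sum.reindex_bij_betw[OF g, of p]
      sum.reindex_bij_betw[OF g, of "\<lambda>k. H k / ?n"] by (simp_all add: sum_divide_distrib)
  show ?thesis
    unfolding cond_rel_entropy_def
  proof (rule Sup_eqI)
    fix y assume "y \<in> {ereal (\<Sum>i<k. ?h (x i)) | (k::nat) (x :: nat \<Rightarrow> 'n cmat).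
            (\<forall>i<k. positive_mat (x i)) \<and> (\<Sum>i<k. x i) = mat 1}"
    then show "y \<le> ereal (overlap_entropy u v)" using upper ereal_less_eq(3) by blast
  next
    fix y assume *: "\<And>z. z \<in> {ereal (\<Sum>i<k. ?h (x i)) | (k::nat) (x :: nat \<Rightarrow> 'n cmat).
            (\<forall>i<k. positive_mat (x i)) \<and> (\<Sum>i<k. x i) = mat 1} \<Longrightarrow> z \<le> y"
    show "ereal (overlap_entropy u v) \<le> y"
      unfolding attained(1)[symmetric]
      using attained(2) p by (intro * CollectI exI[of _ "CARD('n)"] exI[of _ "\<lambda>k. p (g k)"]) simp
  qed
qed

section \<open>Orthogonality as constancy of the overlaps\<close>

text \<open>Constant overlaps replace every coefficient by the mean of the diagonal of
  \<open>x\<close>, which is its normalized trace.\<close>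

lemma cond_exp_comp_const_overlap:
  fixes u v :: "'n::finite cmat"
  assumes u: "unitary_mat u" and v: "unitary_mat v" and c: "\<And>i j. overlap u v i j = 1 / real CARD('n)"
  shows "cond_exp (range (conj_diag v)) \<circ> cond_exp (range (conj_diag u)) = cond_exp scalar_mats"
proof
  fix x
  have "conj_entry v (conj_diag u (conj_entry u x)) = (\<lambda>_. ntrace x)"
    by (rule ext) (simp add: conj_entry_overlap c ntrace_eq_conj_entry[OF u] sum_divide_distrib)
  then show "(cond_exp (range (conj_diag v)) \<circ> cond_exp (range (conj_diag u))) x = cond_exp scalar_mats x"
    by (simp add: cond_exp_conj_diag u v cond_exp_scalar_mats conj_diag_const)
qed

lemma popa_orthogonal_conj_diag_iff:
  fixes u v :: "'n::finite cmat"
  assumes u: "unitary_mat u" and v: "unitary_mat v"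
  shows "popa_orthogonal (range (conj_diag u)) (range (conj_diag v))
    \<longleftrightarrow> (\<forall>i j. overlap u v i j = 1 / real CARD('n))" (is "popa_orthogonal ?A ?B \<longleftrightarrow> _")
proof
  assume "popa_orthogonal ?A ?B"
  then have E: "cond_exp ?B \<circ> cond_exp ?A = cond_exp scalar_mats"
    by (simp add: popa_orthogonal_def)
  show "\<forall>i j. overlap u v i j = 1 / real CARD('n)"
  proof (intro allI)
    fix i j
    \<comment> \<open>A minimal projection of \<open>?A\<close> has normalized trace 1/n, and
      coefficient j of its expectation onto \<open>?B\<close> is the overlap at (i, j).\<close>
    define p where "p = conj_diag u (\<lambda>k. if k = i then 1 else 0)"
    have "ntrace p = 1 / of_nat CARD('n)"
      by (simp add: ntrace_eq_conj_entry[OF u] p_def conj_entry_conj_diag[OF u])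
    moreover have "conj_diag v (conj_entry v p) = conj_diag v (\<lambda>_. ntrace p)"
      using fun_cong[OF E, of p]
      by (simp add: cond_exp_conj_diag u v cond_exp_scalar_mats conj_diag_const p_def conj_entry_conj_diag)
    then have "conj_entry v p j = ntrace p"
      using conj_entry_conj_diag[OF v] by (auto dest: arg_cong[of _ _ "\<lambda>y. conj_entry v y j"])
    moreover have "conj_entry v p j = of_real (overlap u v i j)"
      by (simp add: p_def conj_entry_overlap if_distrib cong: if_cong)
    ultimately have "complex_of_real (overlap u v i j) = of_real (1 / real CARD('n))" by simp
    then show "overlap u v i j = 1 / real CARD('n)" using of_real_eq_iff by blast
  qed
next
  assume c: "\<forall>i j. overlap u v i j = 1 / real CARD('n)"
  have BA: "cond_exp ?B \<circ> cond_exp ?A = cond_exp scalar_mats"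
    using c by (intro cond_exp_comp_const_overlap u v) blast
  have AB: "cond_exp ?A \<circ> cond_exp ?B = cond_exp scalar_mats"
    using c by (intro cond_exp_comp_const_overlap u v) (simp add: overlap_commute)
  have "?A \<inter> ?B = scalar_mats"
  proof
    show "?A \<inter> ?B \<subseteq> scalar_mats"
    proof
      fix x assume x: "x \<in> ?A \<inter> ?B"
      then obtain c d where xu: "x = conj_diag u c" and xv: "x = conj_diag v d" by blast
      \<comment> \<open>An element of both algebras is fixed by both expectations, hence by their
        composite, which is the scalar expectation.\<close>
      have "cond_exp ?A x = x"
        unfolding xu by (simp add: cond_exp_conj_diag u conj_entry_conj_diag)
      moreover have "cond_exp ?B x = x"
        unfolding xv by (simp add: cond_exp_conj_diag v conj_entry_conj_diag)
      ultimately have "x = cscale (ntrace x) (mat 1)"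
        using fun_cong[OF BA, of x] by (simp add: cond_exp_scalar_mats)
      then show "x \<in> scalar_mats" unfolding scalar_mats_def by blast
    qed
    show "scalar_mats \<subseteq> ?A \<inter> ?B"
      unfolding scalar_mats_def
      by (auto simp flip: conj_diag_const[OF u]) (simp add: conj_diag_const u flip: conj_diag_const[OF v])
  qed
  then show "popa_orthogonal ?A ?B" by (simp add: popa_orthogonal_def AB BA)
qed

theorem corollary5:
  fixes A0 B0 :: "(complex^'n::finite^'n) set"
  assumes "masa A0" and "masa B0"
  shows "popa_orthogonal A0 B0 \<longleftrightarrow>
    cond_rel_entropy A0 B0 = ereal (ln (real CARD('n))) \<and>
    is_maximum (ereal (ln (real CARD('n))))
      {cond_rel_entropy A B | (A :: (complex^'n^'n) set) (B :: (complex^'n^'n) set).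
         masa A \<and> masa B}"
proof -
  obtain u where u: "unitary_mat u" "A0 = range (conj_diag u)"
    using masa_eq_range_conj_diag[OF assms(1)] .
  obtain v where v: "unitary_mat v" "B0 = range (conj_diag v)"
    using masa_eq_range_conj_diag[OF assms(2)] .
  have le: "cond_rel_entropy A B \<le> ereal (ln (real CARD('n)))" if "masa A" "masa B"
    for A B :: "'n cmat set"
    using that by (auto elim!: masa_eq_range_conj_diag simp: cond_rel_entropy_conj_diag overlap_entropy_le)
  \<comment> \<open>The given pair is itself a competitor, so once it attains the universal upper
    bound that bound is a maximum.\<close>
  have "is_maximum (ereal (ln (real CARD('n)))) {cond_rel_entropy A B | A B :: 'n cmat set. masa A \<and> masa B}"
    if "cond_rel_entropy A0 B0 = ereal (ln (real CARD('n)))"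
    unfolding is_maximum_def using assms that[symmetric] le by blast
  \<comment> \<open>Both sides say that all overlaps equal 1/n.\<close>
  moreover have "popa_orthogonal A0 B0 \<longleftrightarrow> cond_rel_entropy A0 B0 = ereal (ln (real CARD('n)))"
    by (simp add: u v popa_orthogonal_conj_diag_iff cond_rel_entropy_conj_diag overlap_entropy_le)
  ultimately show ?thesis by blast
qed

end
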